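(* For every real $\epsilon>0$ and every $d\in\mathbb{N}$ there exists a constant $E(\epsilon,d)>0$ such that the following holds: for every $t>0$ there exist $k(t),n(t)\in\mathbb{N}$ and a real number $s(t)>0$ (where $k(t),n(t),s(t)$ may also depend on $\epsilon$ and $d$) such that if $G$ is a finite connected graph with all vertex degrees at most $d$, with $|V(G)|\geq n(t)$ and $s(G,E(\epsilon,d))\geq t$, then $m(G,\epsilon,k(t))\geq s(t)$.
   Context: Graphs are simple. For a finite graph $G$, the Laplacian $\Delta_G$ acts on functions $f:V(G)\to\mathbb{C}$ by $\Delta_G f(y)=\deg(y)f(y)-\sum_{z\text{ adjacent to }y}f(z)$. For $\delta>0$ and a finite connected graph $G$, let $S(G,\delta)$ be the collection of eigenvalues of $\Delta_G$, counted with multiplicity, that are not greater than $\delta$, and put $s(G,\delta):=|S(G,\delta)|/|V(G)|$. A spanned subgraph is an induced subgraph; subgraphs $A$ below are nonempty. For a connected spanned subgraph $A$ of $G$, $|A|=|V(A)|$ and $\partial A$ denotes the set of vertices $x\in V(A)$ for which there exists a vertex $y\in V(G)\setminus V(A)$ adjacent to $x$ in $G$. For $\epsilon>0$ and $k\in\mathbb{N}$, $m(G,\epsilon,k)$ denotes $\frac{1}{|V(G)|}$ times the maximal cardinality of a system of pairwise (vertex-)disjoint connected spanned subgraphs $A$ of $G$ satisfying $|A|\leq k$ and $\frac{|\partial A|}{|A|}\leq\epsilon$. *)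

theory Defs
  imports Complex_Main "HOL-Library.Function_Algebras" "Graph_Theory.Graph_Theory"
begin

text \<open>
  Finite simple graphs are the \<^locale>\<open>pair_graph\<close>s of the library: finite, loop-free, symmetric
  digraphs whose arcs are ordered pairs of vertices. Hence \<open>(x, y) \<in> parcs G\<close> is adjacency and the
  out-degree is the degree.
\<close>

definition cscale :: "complex \<Rightarrow> ('a \<Rightarrow> complex) \<Rightarrow> 'a \<Rightarrow> complex" where
  "cscale c f = (\<lambda>x. c * f x)"

interpretation cfun: vector_space cscale
  by unfold_locales (auto simp: cscale_def fun_eq_iff algebra_simps)

definition laplacian :: "'a pair_pre_digraph \<Rightarrow> ('a \<Rightarrow> complex) \<Rightarrow> 'a \<Rightarrow> complex" where
  "laplacian G f y =
     of_nat (out_degree (with_proj G) y) * f y - (\<Sum>z | (y, z) \<in> parcs G. f z)"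

text \<open>
  A function \<open>V(G) \<rightarrow> \<complex>\<close> is represented by its extension by zero to the whole vertex type.
\<close>

definition eigenspace :: "'a pair_pre_digraph \<Rightarrow> complex \<Rightarrow> ('a \<Rightarrow> complex) set" where
  "eigenspace G \<mu> =
     {f. (\<forall>x. x \<notin> pverts G \<longrightarrow> f x = 0) \<and> (\<forall>y\<in>pverts G. laplacian G f y = \<mu> * f y)}"

definition is_eigenvalue :: "'a pair_pre_digraph \<Rightarrow> complex \<Rightarrow> bool" where
  "is_eigenvalue G \<mu> \<longleftrightarrow> (\<exists>f\<in>eigenspace G \<mu>. f \<noteq> 0)"

definition eigenvalue_multiplicity :: "'a pair_pre_digraph \<Rightarrow> complex \<Rightarrow> nat" where
  "eigenvalue_multiplicity G \<mu> = cfun.dim (eigenspace G \<mu>)"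

text \<open>
  The Laplacian is self-adjoint, so its eigenvalues are real (which gives meaning to \<open>\<le> \<delta>\<close>), there
  are finitely many of them, and geometric and algebraic multiplicities coincide.
\<close>

definition num_small_eigenvalues :: "'a pair_pre_digraph \<Rightarrow> real \<Rightarrow> nat" where
  "num_small_eigenvalues G \<delta> =
     (\<Sum>r | is_eigenvalue G (complex_of_real r) \<and> r \<le> \<delta>.
        eigenvalue_multiplicity G (complex_of_real r))"

definition small_eigenvalue_ratio :: "'a pair_pre_digraph \<Rightarrow> real \<Rightarrow> real" where
  "small_eigenvalue_ratio G \<delta> = real (num_small_eigenvalues G \<delta>) / real (card (pverts G))"

definition vertex_boundary :: "'a pair_pre_digraph \<Rightarrow> 'a pair_pre_digraph \<Rightarrow> 'a set" where
  "vertex_boundary G A = {x \<in> pverts A. \<exists>y \<in> pverts G - pverts A. (x, y) \<in> parcs G}"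

text \<open>Connected graphs are nonempty by the library's definition.\<close>

definition isoperimetric_system ::
  "'a pair_pre_digraph \<Rightarrow> real \<Rightarrow> nat \<Rightarrow> 'a pair_pre_digraph set \<Rightarrow> bool" where
  "isoperimetric_system G \<epsilon> k \<A> \<longleftrightarrow>
     (\<forall>A\<in>\<A>. induced_subgraph (with_proj A) (with_proj G)
        \<and> Digraph_Component.connected (with_proj A)
        \<and> card (pverts A) \<le> k
        \<and> real (card (vertex_boundary G A)) / real (card (pverts A)) \<le> \<epsilon>)
     \<and> pairwise (\<lambda>A B. disjnt (pverts A) (pverts B)) \<A>"

definition isoperimetric_ratio :: "'a pair_pre_digraph \<Rightarrow> real \<Rightarrow> nat \<Rightarrow> real" where
  "isoperimetric_ratio G \<epsilon> k =
     real (Max {card \<A> |\<A>. isoperimetric_system G \<epsilon> k \<A>}) / real (card (pverts G))"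

end

theory Submission
  imports Defs "HOL-Analysis.Convex"
begin

text \<open>
  Let \<open>D > d\<close> and let \<open>T = I - \<Delta> / (2D)\<close>, a lazy random walk. For a vertex \<open>x\<close>, the function
  \<open>T\<^sup>m \<delta>\<^sub>x\<close> (called \<open>heat m x\<close>) is supported in the ball of radius \<open>m\<close> about \<open>x\<close>, whose size is
  bounded in terms of \<open>d\<close> and \<open>m\<close> only. The heat mass \<open>\<sigma>\<^sub>m = (\<Sum>x. \<bar>T\<^sup>m \<delta>\<^sub>x\<bar>\<^sup>2)\<close> is the squared
  Hilbert--Schmidt norm of \<open>T\<^sup>m\<close>, so the eigenvalues up to \<open>E\<close> contribute at least
  \<open>t |V| (1 - E / (2D))\<^bsup>2m\<^esup>\<close> to it (\<open>num_small_eigenvalues_heat_mass\<close>). Since \<open>\<sigma>\<^sub>0 = |V|\<close>, the mass cannot lose a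
  fraction \<open>b = 2E/D\<close> at each of the first \<open>M\<close> steps when \<open>M\<close> is large in terms of
  \<open>t\<close>: that would be about twice the rate \<open>E/D\<close> at which the lower bound decays. So some step \<open>m < M\<close> loses at most the fraction \<open>b\<close> (\<open>ex_step_small_loss\<close>). This is the
  point that makes \<open>E\<close> independent of \<open>t\<close>: only the time \<open>M\<close>, and with it the size of
  the pieces, depends on \<open>t\<close>.

  The mass lost by a function in one step controls its Dirichlet energy
  (\<open>energy_le_mass_loss\<close>). Hence at step \<open>m\<close> the functions \<open>T\<^sup>m \<delta>\<^sub>x\<close> have small energy on average, and as
  each has norm at most \<open>1\<close>, a definite proportion of the vertices \<open>x\<close> have a small Rayleigh quotient
  (\<open>card_low_energy_centres\<close>). For such an \<open>x\<close>, Cheeger's argument finds a set with small boundary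
  within the support (\<open>low_energy_imp_small_boundary\<close>), and a smallest one is connected
  (\<open>connected_small_boundary\<close>). Each piece found in this way lies in a ball of bounded size about its
  centre, so a positive proportion of them can be made disjoint (\<open>packing_bound\<close>).
\<close>

locale bounded_degree_graph = pair_graph G for G :: "'a pair_pre_digraph" +
  fixes D :: nat
  assumes D_pos: "D > 0"
    and degree_le: "x \<in> pverts G \<Longrightarrow> out_degree (with_proj G) x \<le> D"
begin

section \<open>The Laplacian as a quadratic form\<close>

definition nbrs :: "'a \<Rightarrow> 'a set" where
  "nbrs x = {z. (x, z) \<in> parcs G}"

definition inner_prod :: "('a \<Rightarrow> complex) \<Rightarrow> ('a \<Rightarrow> complex) \<Rightarrow> complex" where
  "inner_prod f g = (\<Sum>x\<in>pverts G. f x * cnj (g x))"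

definition sqnorm :: "('a \<Rightarrow> complex) \<Rightarrow> real" where
  "sqnorm f = (\<Sum>x\<in>pverts G. (cmod (f x))\<^sup>2)"

text \<open>The sum runs over ordered pairs, so this is twice the usual Dirichlet form.\<close>

definition energy :: "('a \<Rightarrow> complex) \<Rightarrow> real" where
  "energy f = (\<Sum>y\<in>pverts G. \<Sum>z\<in>nbrs y. (cmod (f y - f z))\<^sup>2)"

lemma finite_V [simp]: "finite (pverts G)"
  by (rule pair_finite_verts)

lemma nbrs_subset: "nbrs x \<subseteq> pverts G"
  by (auto simp: nbrs_def dest: in_arcsD2)

lemma finite_nbrs [simp]: "finite (nbrs x)"
  by (rule finite_subset[OF nbrs_subset]) simp

lemma nbrs_sym: "z \<in> nbrs y \<longleftrightarrow> y \<in> nbrs z"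
  by (auto simp: nbrs_def dest: arcs_symmetric)

lemma out_degree_nbrs: "out_degree (with_proj G) x = card (nbrs x)"
proof -
  have "out_arcs (with_proj G) x = Pair x ` nbrs x"
    by (auto simp: out_arcs_def nbrs_def)
  then show ?thesis
    by (simp add: out_degree_def card_image inj_on_def)
qed

lemma card_nbrs_le: "x \<in> pverts G \<Longrightarrow> card (nbrs x) \<le> D"
  using degree_le[of x] by (simp add: out_degree_nbrs)

lemma laplacian_eq: "laplacian G f y = (\<Sum>z\<in>nbrs y. f y - f z)"
  by (simp add: laplacian_def out_degree_nbrs sum_subtractf flip: nbrs_def)

lemma sum_arcs_swap:
  fixes h :: "'a \<Rightarrow> 'a \<Rightarrow> 'b::comm_monoid_add"
  shows "(\<Sum>y\<in>pverts G. \<Sum>z\<in>nbrs y. h y z) = (\<Sum>y\<in>pverts G. \<Sum>z\<in>nbrs y. h z y)"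
proof -
  have 1: "nbrs y = {z \<in> pverts G. z \<in> nbrs y}" for y
    using nbrs_subset by auto
  have 2: "nbrs z = {y \<in> pverts G. z \<in> nbrs y}" for z
    using nbrs_subset nbrs_sym by blast
  have "(\<Sum>y\<in>pverts G. \<Sum>z\<in>nbrs y. h y z) = (\<Sum>y\<in>pverts G. \<Sum>z\<in>{z \<in> pverts G. z \<in> nbrs y}. h y z)"
    by (simp only: 1[symmetric])
  also have "\<dots> = (\<Sum>z\<in>pverts G. \<Sum>y\<in>{y \<in> pverts G. z \<in> nbrs y}. h y z)"
    by (rule sum.swap_restrict) auto
  also have "\<dots> = (\<Sum>z\<in>pverts G. \<Sum>y\<in>nbrs z. h y z)"
    by (simp only: 2[symmetric])
  finally show ?thesis .
qed

lemma laplacian_form: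
  "inner_prod (laplacian G f) g
     = (\<Sum>y\<in>pverts G. \<Sum>z\<in>nbrs y. (f y - f z) * cnj (g y - g z)) / 2"
proof -
  have A: "inner_prod (laplacian G f) g = (\<Sum>y\<in>pverts G. \<Sum>z\<in>nbrs y. (f y - f z) * cnj (g y))"
    by (simp add: inner_prod_def laplacian_eq sum_distrib_right)
  have B: "inner_prod (laplacian G f) g = (\<Sum>y\<in>pverts G. \<Sum>z\<in>nbrs y. (f z - f y) * cnj (g z))"
    unfolding A by (rule sum_arcs_swap)
  have "inner_prod (laplacian G f) g + inner_prod (laplacian G f) g
      = (\<Sum>y\<in>pverts G. \<Sum>z\<in>nbrs y. (f y - f z) * cnj (g y - g z))"
    by (subst A, subst B) (simp add: algebra_simps flip: sum.distrib)
  moreover have half: "a + a = b \<Longrightarrow> a = b / 2" for a b :: complex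
    by auto
  ultimately show ?thesis by (intro half)
qed

lemma laplacian_selfadjoint: "inner_prod (laplacian G f) g = inner_prod f (laplacian G g)"
proof -
  have "inner_prod f (laplacian G g) = cnj (inner_prod (laplacian G g) f)"
    by (simp add: inner_prod_def mult.commute)
  also have "\<dots> = inner_prod (laplacian G f) g"
    unfolding laplacian_form by (simp add: mult.commute)
  finally show ?thesis by (rule sym)
qed

lemma inner_prod_self: "inner_prod f f = complex_of_real (sqnorm f)"
  by (simp add: inner_prod_def sqnorm_def complex_norm_square flip: of_real_power)

lemma energy_eq_form: "complex_of_real (energy f) = 2 * inner_prod (laplacian G f) f"
  by (simp add: laplacian_form energy_def complex_norm_square flip: of_real_power)

lemma sqnorm_nonneg: "sqnorm f \<ge> 0"
  by (simp add: sqnorm_def sum_nonneg)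

lemma energy_nonneg: "energy f \<ge> 0"
  by (simp add: energy_def sum_nonneg)

lemma sqnorm_eq_0: "sqnorm f = 0 \<Longrightarrow> x \<in> pverts G \<Longrightarrow> f x = 0"
  by (simp add: sqnorm_def sum_nonneg_eq_0_iff)

text \<open>By Cauchy--Schwarz over the at most \<open>D\<close> neighbours of each vertex.\<close>

lemma sqnorm_laplacian_le: "sqnorm (laplacian G f) \<le> D * energy f"
proof -
  have "(cmod (laplacian G f y))\<^sup>2 \<le> D * (\<Sum>z\<in>nbrs y. (cmod (f y - f z))\<^sup>2)"
    if "y \<in> pverts G" for y
  proof -
    have "(cmod (laplacian G f y))\<^sup>2 \<le> (\<Sum>z\<in>nbrs y. cmod (f y - f z))\<^sup>2"
      unfolding laplacian_eq by (intro power_mono norm_sum) auto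
    also have "\<dots> \<le> (\<Sum>z\<in>nbrs y. (cmod (f y - f z))\<^sup>2) * card (nbrs y)"
      by (rule sum_squared_le_sum_of_squares)
    also have "\<dots> \<le> (\<Sum>z\<in>nbrs y. (cmod (f y - f z))\<^sup>2) * D"
      using card_nbrs_le[OF that] by (intro mult_left_mono) (auto intro: sum_nonneg)
    finally show ?thesis by (simp add: mult.commute)
  qed
  then show ?thesis
    unfolding sqnorm_def energy_def sum_distrib_left[of "real D"] by (intro sum_mono) 
qed


section \<open>The lazy random walk\<close>

text \<open>The operator \<open>I - \<Delta> / (2D)\<close>; cutting off outside \<open>V(G)\<close> keeps it among the functions
  that are extended by zero.\<close>

definition lazy_step :: "('a \<Rightarrow> complex) \<Rightarrow> 'a \<Rightarrow> complex" where
  "lazy_step f y = (if y \<in> pverts G then f y - laplacian G f y / of_nat (2 * D) else 0)"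

definition heat :: "nat \<Rightarrow> 'a \<Rightarrow> 'a \<Rightarrow> complex" where
  "heat m x = (lazy_step ^^ m) (\<lambda>y. if y = x then 1 else 0)"

definition heat_mass :: "nat \<Rightarrow> real" where
  "heat_mass m = (\<Sum>x\<in>pverts G. sqnorm (heat m x))"

text \<open>Expanding the square, the cross term contributes \<open>- energy f / (2D)\<close> and
  the quadratic term at most half of that, so a function that loses little mass in one
  step has small energy.\<close>

lemma energy_le_mass_loss: "energy f \<le> 4 * D * (sqnorm f - sqnorm (lazy_step f))"
proof -
  have pt: "(cmod (a - b / of_nat (2 * D)))\<^sup>2
      = (cmod a)\<^sup>2 - Re (b * cnj a) / D + (cmod b)\<^sup>2 / (4 * (real D)\<^sup>2)" for a b :: complex
    using D_pos unfolding cmod_power2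
    by (simp add: field_simps power2_eq_square)
  have "sqnorm (lazy_step f) = (\<Sum>y\<in>pverts G. (cmod (f y))\<^sup>2
      - Re (laplacian G f y * cnj (f y)) / D + (cmod (laplacian G f y))\<^sup>2 / (4 * (real D)\<^sup>2))"
    unfolding sqnorm_def by (intro sum.cong) (simp_all only: lazy_step_def if_True pt)
  also have "\<dots> = sqnorm f - Re (inner_prod (laplacian G f) f) / D
      + sqnorm (laplacian G f) / (4 * (real D)\<^sup>2)"
    by (simp add: sqnorm_def inner_prod_def sum.distrib sum_subtractf add_divide_distrib
        flip: sum_divide_distrib)
  also have "Re (inner_prod (laplacian G f) f) = energy f / 2"
    using arg_cong[OF energy_eq_form[of f], of Re] by simp
  finally have eq: "sqnorm (lazy_step f)
      = sqnorm f - energy f / 2 / D + sqnorm (laplacian G f) / (4 * (real D)\<^sup>2)" .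
  have "sqnorm (laplacian G f) / (4 * (real D)\<^sup>2) \<le> D * energy f / (4 * (real D)\<^sup>2)"
    by (intro divide_right_mono sqnorm_laplacian_le) auto
  also have "\<dots> = energy f / (4 * D)"
    using D_pos by (simp add: power2_eq_square)
  finally have "sqnorm (laplacian G f) / (4 * (real D)\<^sup>2) \<le> energy f / (4 * D)" .
  moreover have "energy f / 2 / D = 2 * (energy f / (4 * D))"
    by simp
  ultimately have "sqnorm (lazy_step f) \<le> sqnorm f - energy f / (4 * D)"
    using eq by linarith
  then show ?thesis
    using D_pos by (simp add: field_simps)
qed

lemma sqnorm_lazy_step_le: "sqnorm (lazy_step f) \<le> sqnorm f"
proof -
  have "0 \<le> (4 * real D) * (sqnorm f - sqnorm (lazy_step f))"
    using energy_le_mass_loss[of f] energy_nonneg[of f] by simp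
  then show ?thesis
    using D_pos by (simp add: zero_le_mult_iff)
qed

lemma heat_Suc: "heat (Suc m) x = lazy_step (heat m x)"
  by (simp add: heat_def)

lemma sqnorm_heat_0: "x \<in> pverts G \<Longrightarrow> sqnorm (heat 0 x) = 1"
  by (simp add: sqnorm_def heat_def if_distrib[of "\<lambda>c. (cmod c)\<^sup>2"] cong: if_cong)

lemma sqnorm_heat_le: "x \<in> pverts G \<Longrightarrow> sqnorm (heat m x) \<le> 1"
proof (induction m)
  case 0
  then show ?case by (simp add: sqnorm_heat_0)
next
  case (Suc m)
  then show ?case
    using sqnorm_lazy_step_le[of "heat m x"] by (simp add: heat_Suc)
qed

lemma heat_mass_0: "heat_mass 0 = card (pverts G)"
  by (simp add: heat_mass_def sqnorm_heat_0)

lemma inner_prod_eigen: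
  assumes "e \<in> eigenspace G (complex_of_real r)"
  shows "inner_prod (laplacian G f) e = r * inner_prod f e"
  using assms
  by (simp add: laplacian_selfadjoint)
     (simp add: inner_prod_def eigenspace_def sum_distrib_left mult.left_commute)

lemma inner_prod_heat_eigen:
  assumes "e \<in> eigenspace G (complex_of_real r)" "x \<in> pverts G"
  shows "inner_prod (heat m x) e = (1 - r / (2 * D)) ^ m * cnj (e x)"
proof (induction m)
  case 0
  show ?case
    using assms(2)
    by (simp add: inner_prod_def heat_def if_distrib[of "\<lambda>c. c * _"] cong: if_cong)
next
  case (Suc m)
  have step: "inner_prod (lazy_step f) e
      = inner_prod f e - inner_prod (laplacian G f) e / of_nat (2 * D)" for f
    unfolding inner_prod_def sum_divide_distrib sum_subtractf[symmetric]
    by (intro sum.cong) (simp_all add: lazy_step_def algebra_simps)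
  show ?case
    unfolding heat_Suc step inner_prod_eigen[OF assms(1)] Suc by (simp add: algebra_simps)
qed


section \<open>Counting small eigenvalues by the heat mass\<close>

definition small_eigenvectors :: "real \<Rightarrow> ('a \<Rightarrow> complex) set" where
  "small_eigenvectors E = (\<Union>r\<in>{..E}. eigenspace G (complex_of_real r))"

definition orthonormal :: "('a \<Rightarrow> complex) set \<Rightarrow> bool" where
  "orthonormal S \<longleftrightarrow> (\<forall>e\<in>S. \<forall>f\<in>S. inner_prod e f = (if e = f then 1 else 0))"

lemma sqnorm_projection:
  assumes "finite S" "orthonormal S"
  shows "sqnorm (\<lambda>x. f x - (\<Sum>e\<in>S. inner_prod f e * e x))
    = sqnorm f - (\<Sum>e\<in>S. (cmod (inner_prod f e))\<^sup>2)"
    and "g \<in> S \<Longrightarrow> inner_prod (\<lambda>x. f x - (\<Sum>e\<in>S. inner_prod f e * e x)) g = 0"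
proof -
  define p where "p = (\<lambda>x. \<Sum>e\<in>S. inner_prod f e * e x)"
  have diff: "inner_prod (\<lambda>x. u x - v x) h = inner_prod u h - inner_prod v h" for u v h
    by (simp add: inner_prod_def algebra_simps sum_subtractf)
  have p_left: "inner_prod p h = (\<Sum>e\<in>S. inner_prod f e * inner_prod e h)" for h
    unfolding p_def inner_prod_def[of _ h] sum_distrib_right sum_distrib_left
    by (subst sum.swap) (simp add: mult.assoc)
  have orth: "inner_prod (\<lambda>x. f x - p x) g = 0" if "g \<in> S" for g
  proof -
    have "inner_prod p g = (\<Sum>e\<in>S. if e = g then inner_prod f g else 0)"
      unfolding p_left using assms(2) that by (intro sum.cong) (auto simp: orthonormal_def)
    then show ?thesis
      using assms(1) that by (simp add: diff)
  qed
  then show "g \<in> S \<Longrightarrow> inner_prod (\<lambda>x. f x - (\<Sum>e\<in>S. inner_prod f e * e x)) g = 0"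
    by (simp add: p_def)
  have conj: "inner_prod u v = cnj (inner_prod v u)" for u v
    by (simp add: inner_prod_def mult.commute)
  have "inner_prod p (\<lambda>x. f x - p x) = 0"
    unfolding p_left by (rule sum.neutral) (use orth conj in \<open>metis complex_cnj_zero mult_zero_right\<close>)
  then have "inner_prod (\<lambda>x. f x - p x) (\<lambda>x. f x - p x) = inner_prod f (\<lambda>x. f x - p x)"
    by (simp add: diff)
  also have "\<dots> = cnj (inner_prod (\<lambda>x. f x - p x) f)"
    by (rule conj)
  also have "\<dots> = cnj (inner_prod f f) - cnj (inner_prod p f)"
    by (simp add: diff)
  also have "inner_prod p f = complex_of_real (\<Sum>e\<in>S. (cmod (inner_prod f e))\<^sup>2)"
    unfolding p_left of_real_sum
    by (intro sum.cong) (auto simp: complex_norm_square conj[of _ f] simp flip: of_real_power)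
  finally have "complex_of_real (sqnorm (\<lambda>x. f x - p x))
      = complex_of_real (sqnorm f - (\<Sum>e\<in>S. (cmod (inner_prod f e))\<^sup>2))"
    by (simp add: inner_prod_self)
  then show "sqnorm (\<lambda>x. f x - (\<Sum>e\<in>S. inner_prod f e * e x))
    = sqnorm f - (\<Sum>e\<in>S. (cmod (inner_prod f e))\<^sup>2)"
    unfolding of_real_eq_iff p_def .
qed

lemma bessel:
  assumes "finite S" "orthonormal S"
  shows "(\<Sum>e\<in>S. (cmod (inner_prod f e))\<^sup>2) \<le> sqnorm f"
  using sqnorm_projection(1)[OF assms, of f]
    sqnorm_nonneg[of "\<lambda>x. f x - (\<Sum>e\<in>S. inner_prod f e * e x)"] by simp

text \<open>Bessel's inequality for \<open>heat m x\<close> against eigenvectors, summed over \<open>x\<close>: this is the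
  lower bound of a Hilbert--Schmidt norm by part of the spectrum.\<close>

lemma heat_mass_ge:
  fixes E :: real
  assumes "finite S" "orthonormal S" "S \<subseteq> small_eigenvectors E" "E \<le> 2 * D"
  shows "(1 - E / (2 * D)) ^ (2 * m) * card S \<le> heat_mass m"
proof -
  define c where "c = 1 - E / (2 * D)"
  have c0: "c \<ge> 0"
    using assms(4) D_pos by (simp add: c_def field_simps)
  have term_le: "c ^ (2 * m) * (cmod (e x))\<^sup>2 \<le> (cmod (inner_prod (heat m x) e))\<^sup>2"
    if e: "e \<in> S" and x: "x \<in> pverts G" for e x
  proof -
    obtain r where r: "r \<le> E" "e \<in> eigenspace G (complex_of_real r)"
      using assms(3) e by (auto simp: small_eigenvectors_def)
    have "c \<le> 1 - r / (2 * D)"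
      using r(1) by (simp add: c_def divide_right_mono)
    then have "c ^ (2 * m) \<le> (1 - r / (2 * D)) ^ (2 * m)"
      using c0 by (rule power_mono)
    moreover have "(cmod (inner_prod (heat m x) e))\<^sup>2
        = (1 - r / (2 * D)) ^ (2 * m) * (cmod (e x))\<^sup>2"
      unfolding inner_prod_heat_eigen[OF r(2) x] norm_mult power_mult_distrib norm_of_real power2_abs
      by (simp add: power_mult[symmetric] mult.commute[of 2])
    ultimately show ?thesis
      by (simp add: mult_right_mono)
  qed
  have "c ^ (2 * m) * card S = (\<Sum>e\<in>S. c ^ (2 * m) * sqnorm e)"
  proof -
    have "sqnorm e = 1" if "e \<in> S" for e
      using assms(2) that inner_prod_self[of e] by (simp add: orthonormal_def)
    then show ?thesis by simp
  qed
  also have "\<dots> = (\<Sum>x\<in>pverts G. \<Sum>e\<in>S. c ^ (2 * m) * (cmod (e x))\<^sup>2)"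
    unfolding sqnorm_def sum_distrib_left by (rule sum.swap)
  also have "\<dots> \<le> (\<Sum>x\<in>pverts G. \<Sum>e\<in>S. (cmod (inner_prod (heat m x) e))\<^sup>2)"
    by (intro sum_mono term_le)
  also have "\<dots> \<le> heat_mass m"
    unfolding heat_mass_def by (intro sum_mono bessel assms)
  finally show ?thesis
    by (simp add: c_def)
qed

lemma orthonormal_card_le:
  fixes E :: real
  assumes "finite S" "orthonormal S" "S \<subseteq> small_eigenvectors E" "E \<le> 2 * D"
  shows "card S \<le> card (pverts G)"
  using heat_mass_ge[OF assms, of 0] by (simp add: heat_mass_0)

lemma inner_prod_distinct_eigenvalues:
  assumes "e \<in> eigenspace G (complex_of_real r)" "f \<in> eigenspace G (complex_of_real s)" "r \<noteq> s"
  shows "inner_prod f e = 0"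
proof -
  have "inner_prod (laplacian G f) e = s * inner_prod f e"
    using assms(2) by (simp add: inner_prod_def eigenspace_def sum_distrib_left mult.assoc)
  then have "complex_of_real s * inner_prod f e = complex_of_real r * inner_prod f e"
    using inner_prod_eigen[OF assms(1), of f] by metis
  then show ?thesis
    by (metis assms(3) mult_right_cancel of_real_eq_iff)
qed

lemma laplacian_diff_scale_sum:
  "laplacian G (\<lambda>x. f x - (\<Sum>e\<in>S. c e * e x)) y
     = laplacian G f y - (\<Sum>e\<in>S. c e * laplacian G e y)"
proof -
  have "(\<Sum>z\<in>nbrs y. \<Sum>e\<in>S. c e * e z) = (\<Sum>e\<in>S. \<Sum>z\<in>nbrs y. c e * e z)"
    by (rule sum.swap)
  then show ?thesis
    by (simp add: laplacian_eq sum_subtractf sum_distrib_left sum_distrib_right right_diff_distrib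
        mult.left_commute)
qed

lemma eigenspace_projection:
  assumes "S \<subseteq> eigenspace G \<nu>" "f \<in> eigenspace G \<nu>"
  shows "(\<lambda>x. f x - (\<Sum>e\<in>S. c e * e x)) \<in> eigenspace G \<nu>"
proof -
  have 1: "(\<Sum>e\<in>S. c e * e x) = 0" if "x \<notin> pverts G" for x
    using assms(1) that by (intro sum.neutral) (auto simp: eigenspace_def)
  have 2: "(\<Sum>e\<in>S. c e * laplacian G e y) = \<nu> * (\<Sum>e\<in>S. c e * e y)" if "y \<in> pverts G" for y
    unfolding sum_distrib_left
    using assms(1) that by (intro sum.cong) (auto simp: eigenspace_def)
  show ?thesis
    using assms(2) 1 2 by (auto simp: eigenspace_def laplacian_diff_scale_sum right_diff_distrib)
qed

lemma eigenspace_scale: "f \<in> eigenspace G \<nu> \<Longrightarrow> (\<lambda>x. c * f x) \<in> eigenspace G \<nu>"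
  by (auto simp: eigenspace_def laplacian_eq mult.left_commute simp flip: right_diff_distrib sum_distrib_left)

lemma sum_fun_apply: "(\<Sum>e\<in>S. F e) x = (\<Sum>e\<in>S. F e x :: 'c :: comm_monoid_add)"
  by (induction S rule: infinite_finite_induct) auto

text \<open>A maximal orthonormal set of eigenvectors spans every eigenspace: otherwise the normalised
  residue of a projection could be added. It is therefore large enough to count eigenvalues
  with multiplicity.\<close>

lemma ex_orthonormal_eigenvectors:
  fixes E :: real
  assumes "E \<le> 2 * D"
  obtains S where "finite S" "orthonormal S" "S \<subseteq> small_eigenvectors E"
    "num_small_eigenvalues G E \<le> card S"
proof -
  define P where "P S \<longleftrightarrow> finite S \<and> orthonormal S \<and> S \<subseteq> small_eigenvectors E" for S
  have "P {}"
    by (simp add: P_def orthonormal_def)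
  moreover have "\<forall>S. P S \<longrightarrow> card S < Suc (card (pverts G))"
    using orthonormal_card_le assms unfolding P_def by (blast intro: le_imp_less_Suc)
  ultimately have "\<exists>S. P S \<and> (\<forall>S'. P S' \<longrightarrow> card S' \<le> card S)"
    by (rule ex_has_greatest_nat)
  then obtain S where S: "P S" and max: "\<And>S'. P S' \<Longrightarrow> card S' \<le> card S"
    by blast
  have fin: "finite S" and orth: "orthonormal S" and sub: "S \<subseteq> small_eigenvectors E"
    using S by (auto simp: P_def)
  define Sr where "Sr r = S \<inter> eigenspace G (complex_of_real r)" for r
  have Sr: "finite (Sr r)" "orthonormal (Sr r)" "Sr r \<subseteq> eigenspace G (complex_of_real r)" for r
    using fin orth by (auto simp: Sr_def orthonormal_def)
  have span: "eigenspace G (complex_of_real r) \<subseteq> cfun.span (Sr r)" if "r \<le> E" for r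
  proof
    fix f assume f: "f \<in> eigenspace G (complex_of_real r)"
    define q where "q = (\<lambda>x. f x - (\<Sum>e\<in>Sr r. inner_prod f e * e x))"
    have q: "q \<in> eigenspace G (complex_of_real r)"
      unfolding q_def by (rule eigenspace_projection[OF Sr(3) f])
    have q_orth: "inner_prod q e = 0" if e: "e \<in> S" for e
    proof (cases "e \<in> Sr r")
      case True
      then show ?thesis
        unfolding q_def by (rule sqnorm_projection(2)[OF Sr(1,2)])
    next
      case False
      obtain s where s: "e \<in> eigenspace G (complex_of_real s)"
        using sub e by (auto simp: small_eigenvectors_def)
      with False e have "s \<noteq> r"
        by (auto simp: Sr_def)
      then show ?thesis
        using inner_prod_distinct_eigenvalues[OF s q] by simp
    qed
    have "sqnorm q = 0"
    proof (rule ccontr)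
      assume "sqnorm q \<noteq> 0"
      then have pos: "sqnorm q > 0"
        using sqnorm_nonneg[of q] by simp
      define u where "u = (\<lambda>x. complex_of_real (1 / sqrt (sqnorm q)) * q x)"
      have u_ip: "inner_prod u e = complex_of_real (1 / sqrt (sqnorm q)) * inner_prod q e" for e
        by (simp add: u_def inner_prod_def sum_distrib_left mult.assoc)
      have conj: "inner_prod v w = cnj (inner_prod w v)" for v w
        by (simp add: inner_prod_def mult.commute)
      have "inner_prod q u = complex_of_real (1 / sqrt (sqnorm q)) * sqnorm q"
        using arg_cong[OF u_ip[of q], of cnj] by (simp add: conj[of q u] inner_prod_self)
      then have uu: "inner_prod u u = 1"
        using pos by (simp add: u_ip flip: of_real_mult)
      have uS: "inner_prod u e = 0" "inner_prod e u = 0" if "e \<in> S" for e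
        using q_orth[OF that] by (simp_all add: u_ip conj[of e])
      have "u \<notin> S"
        using uS uu by force
      have "u \<in> eigenspace G (complex_of_real r)"
        unfolding u_def by (rule eigenspace_scale[OF q])
      then have "P (insert u S)"
        using fin orth sub uu uS \<open>u \<notin> S\<close> \<open>r \<le> E\<close>
        by (auto simp: P_def orthonormal_def small_eigenvectors_def)
      then show False
        using max[of "insert u S"] \<open>u \<notin> S\<close> fin by simp
    qed
    then have "q x = 0" for x
      using sqnorm_eq_0[of q x] q by (cases "x \<in> pverts G") (auto simp: eigenspace_def)
    then have "f = (\<Sum>e\<in>Sr r. cscale (inner_prod f e) e)"
      by (auto simp: fun_eq_iff q_def sum_fun_apply cscale_def)
    also have "\<dots> \<in> cfun.span (Sr r)"
      by (intro cfun.span_sum cfun.span_scale cfun.span_base)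
    finally show "f \<in> cfun.span (Sr r)" .
  qed
  define R where "R = {r. is_eigenvalue G (complex_of_real r) \<and> r \<le> E}"
  have "num_small_eigenvalues G E \<le> card S"
  proof (cases "finite R")
    case True
    have "num_small_eigenvalues G E \<le> (\<Sum>r\<in>R. card (Sr r))"
      unfolding num_small_eigenvalues_def eigenvalue_multiplicity_def R_def[symmetric]
      by (intro sum_mono cfun.dim_le_card span Sr) (auto simp: R_def)
    also have "\<dots> = card (\<Union>r\<in>R. Sr r)"
    proof (rule card_UN_disjoint[symmetric, OF True])
      show "\<forall>r\<in>R. finite (Sr r)"
        using Sr(1) by blast
      have "Sr r \<inter> Sr s = {}" if "r \<noteq> s" for r s
      proof (rule ccontr)
        assume "Sr r \<inter> Sr s \<noteq> {}"
        then obtain e where e: "e \<in> S" "e \<in> eigenspace G (complex_of_real r)"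
            "e \<in> eigenspace G (complex_of_real s)"
          by (auto simp: Sr_def)
        then have "inner_prod e e = 0"
          using inner_prod_distinct_eigenvalues[OF e(2,3) that] by simp
        then show False
          using e(1) orth by (simp add: orthonormal_def)
      qed
      then show "\<forall>r\<in>R. \<forall>s\<in>R. r \<noteq> s \<longrightarrow> Sr r \<inter> Sr s = {}"
        by blast
    qed
    also have "\<dots> \<le> card S"
      by (rule card_mono[OF fin]) (auto simp: Sr_def)
    finally show ?thesis .
  next
    case False
    (* a sum over an infinite set is 0 *)
    then show ?thesis
      by (simp add: num_small_eigenvalues_def flip: R_def)
  qed
  then show ?thesis
    using that fin orth sub by blast
qed

lemma num_small_eigenvalues_heat_mass:
  fixes E :: real
  assumes "E \<le> 2 * D"
  shows "(1 - E / (2 * D)) ^ (2 * m) * num_small_eigenvalues G E \<le> heat_mass m"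
proof -
  obtain S where S: "finite S" "orthonormal S" "S \<subseteq> small_eigenvectors E"
    "num_small_eigenvalues G E \<le> card S"
    using ex_orthonormal_eigenvectors[OF assms] .
  have "(1 - E / (2 * D)) ^ (2 * m) * num_small_eigenvalues G E
      \<le> (1 - E / (2 * D)) ^ (2 * m) * card S"
    using S(4) by (intro mult_left_mono) auto
  also have "\<dots> \<le> heat_mass m"
    by (rule heat_mass_ge[OF S(1-3) assms])
  finally show ?thesis .
qed


section \<open>A Cheeger inequality for functions of small energy\<close>

definition inner_boundary :: "'a set \<Rightarrow> 'a set" where
  "inner_boundary U = {x \<in> U. \<exists>y \<in> pverts G - U. (x, y) \<in> parcs G}"

lemma inner_boundary_subset: "inner_boundary U \<subseteq> U"
  by (auto simp: inner_boundary_def)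

text \<open>The co-area formula, in the form of an induction on the size of the support: subtracting
  the least positive value \<open>c\<close> from a function with support \<open>U\<close> lowers the left-hand
  side by \<open>c \<epsilon> |U|\<close> and the right-hand side by \<open>c\<close> times the number of arcs
  leaving \<open>U\<close>, which is at least the number of boundary vertices.\<close>

lemma coarea_inequality:
  fixes g :: "'a \<Rightarrow> real" and \<epsilon> :: real
  assumes expand: "\<And>U. U \<subseteq> X \<Longrightarrow> U \<noteq> {} \<Longrightarrow> \<epsilon> * card U \<le> card (inner_boundary U)"
    and "\<And>x. g x \<ge> 0" and "X \<subseteq> pverts G" and "{x \<in> pverts G. g x \<noteq> 0} \<subseteq> X"
  shows "\<epsilon> * (\<Sum>y\<in>pverts G. g y) \<le> (\<Sum>y\<in>pverts G. \<Sum>z\<in>nbrs y. max 0 (g y - g z))"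
  using assms(2,4)
proof (induction "card {x \<in> pverts G. g x \<noteq> 0}" arbitrary: g rule: less_induct)
  case less
  define U where "U = {x \<in> pverts G. g x \<noteq> 0}"
  have fin: "finite U" and UV: "U \<subseteq> pverts G"
    by (auto simp: U_def)
  show ?case
  proof (cases "U = {}")
    case True
    then have "(\<Sum>y\<in>pverts G. g y) = 0"
      by (intro sum.neutral) (auto simp: U_def)
    then show ?thesis
      by (simp add: sum_nonneg)
  next
    case False
    define c where "c = Min (g ` U)"
    have c_le: "c \<le> g x" if "x \<in> U" for x
      using that fin by (simp add: c_def)
    have "c \<in> g ` U"
      unfolding c_def using fin False by (intro Min_in) auto
    then obtain x0 where x0: "x0 \<in> U" "c = g x0"
      by blast
    then have c_pos: "c > 0"
      using less.prems(1)[of x0] by (auto simp: U_def)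
    define g' where "g' = (\<lambda>x. if x \<in> U then g x - c else 0)"
    have supp: "{x \<in> pverts G. g' x \<noteq> 0} \<subseteq> U - {x0}"
      using x0 by (auto simp: g'_def split: if_splits)
    then have "card {x \<in> pverts G. g' x \<noteq> 0} \<le> card (U - {x0})"
      using fin by (intro card_mono) auto
    also have "\<dots> < card U"
      using fin x0(1) by (rule card_Diff1_less)
    finally have smaller: "card {x \<in> pverts G. g' x \<noteq> 0} < card {x \<in> pverts G. g x \<noteq> 0}"
      by (simp only: U_def)
    have IH: "\<epsilon> * (\<Sum>y\<in>pverts G. g' y)
        \<le> (\<Sum>y\<in>pverts G. \<Sum>z\<in>nbrs y. max 0 (g' y - g' z))"
    proof (rule less.hyps[OF smaller])
      show "0 \<le> g' x" for x
        using c_le by (simp add: g'_def)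
      show "{x \<in> pverts G. g' x \<noteq> 0} \<subseteq> X"
        using supp less.prems(2) unfolding U_def by blast
    qed
    (* indicator of the arcs leaving U *)
    define b where "b = (\<lambda>y z. if y \<in> U \<and> z \<notin> U then 1 else 0 :: real)"
    have split: "max 0 (g y - g z) = max 0 (g' y - g' z) + c * b y z"
      if "y \<in> pverts G" "z \<in> nbrs y" for y z
    proof -
      have "z \<in> pverts G"
        using that nbrs_subset by auto
      then have "g y = 0" if "y \<notin> U" "y \<in> pverts G" for y
        using that by (simp add: U_def)
      then show ?thesis
        using that less.prems(1)[of y] less.prems(1)[of z] c_pos c_le[of y] c_le[of z] \<open>z \<in> pverts G\<close>
        by (cases "y \<in> U"; cases "z \<in> U") (auto simp: g'_def b_def)
    qed
    have leave: "(if y \<in> inner_boundary U then 1 else 0) \<le> (\<Sum>z\<in>nbrs y. b y z)" for y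
    proof (cases "y \<in> inner_boundary U")
      case True
      then obtain z where z: "z \<in> nbrs y" "z \<notin> U" "y \<in> U"
        by (auto simp: inner_boundary_def nbrs_def)
      then have "b y z \<le> (\<Sum>z\<in>nbrs y. b y z)"
        by (intro member_le_sum) (auto simp: b_def)
      then show ?thesis
        using z True by (simp add: b_def)
    qed (auto simp: b_def intro!: sum_nonneg)
    have bd: "real (card (inner_boundary U)) \<le> (\<Sum>y\<in>pverts G. \<Sum>z\<in>nbrs y. b y z)"
    proof -
      have "inner_boundary U \<inter> pverts G = inner_boundary U"
        using UV inner_boundary_subset by blast
      then have "real (card (inner_boundary U))
          = (\<Sum>y\<in>pverts G. if y \<in> inner_boundary U then 1 else 0)"
        by (simp add: sum.If_cases Int_commute Collect_conv_if)
      also have "\<dots> \<le> (\<Sum>y\<in>pverts G. \<Sum>z\<in>nbrs y. b y z)"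
        by (intro sum_mono leave)
      finally show ?thesis .
    qed
    have mass: "(\<Sum>y\<in>pverts G. g y) = (\<Sum>y\<in>pverts G. g' y) + c * card U"
    proof -
      have "(\<Sum>y\<in>pverts G. g y) = (\<Sum>y\<in>pverts G. g' y + (if y \<in> U then c else 0))"
        by (intro sum.cong) (auto simp: g'_def U_def)
      then show ?thesis
        using UV by (simp add: sum.distrib sum.If_cases Int_absorb1 mult.commute)
    qed
    have "\<epsilon> * (\<Sum>y\<in>pverts G. g y) = \<epsilon> * (\<Sum>y\<in>pverts G. g' y) + c * (\<epsilon> * card U)"
      by (simp add: mass algebra_simps)
    also have "c * (\<epsilon> * card U) \<le> c * card (inner_boundary U)"
      using expand[of U] less.prems(2) False c_pos by (intro mult_left_mono) (auto simp: U_def)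
    also have "c * card (inner_boundary U) \<le> c * (\<Sum>y\<in>pverts G. \<Sum>z\<in>nbrs y. b y z)"
      using bd c_pos by (intro mult_left_mono) auto
    also have "\<epsilon> * (\<Sum>y\<in>pverts G. g' y) + c * (\<Sum>y\<in>pverts G. \<Sum>z\<in>nbrs y. b y z)
        \<le> (\<Sum>y\<in>pverts G. \<Sum>z\<in>nbrs y. max 0 (g' y - g' z) + c * b y z)"
      using IH by (simp add: sum.distrib sum_distrib_left)
    also have "\<dots> = (\<Sum>y\<in>pverts G. \<Sum>z\<in>nbrs y. max 0 (g y - g z))"
      by (intro sum.cong refl) (simp add: split)
    finally show ?thesis by simp
  qed
qed

text \<open>Apply the co-area inequality to \<open>|f|\<^sup>2\<close>. Instead of Cauchy--Schwarz, each difference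
  \<open>|f y|\<^sup>2 - |f z|\<^sup>2\<close> is bounded by the weighted inequality of arithmetic and geometric means, with
  the weight chosen so that both resulting terms are at most a quarter of the mass times
  \<open>\<epsilon>\<close>.\<close>

lemma low_energy_imp_small_boundary:
  fixes \<epsilon> :: real
  assumes "\<epsilon> > 0" and "sqnorm f > 0" and "X \<subseteq> pverts G"
    and "{x \<in> pverts G. f x \<noteq> 0} \<subseteq> X"
    and "energy f \<le> \<epsilon>\<^sup>2 / (16 * D) * sqnorm f"
  shows "\<exists>U\<subseteq>X. U \<noteq> {} \<and> card (inner_boundary U) \<le> \<epsilon> * card U"
proof (rule ccontr)
  assume "\<not> ?thesis"
  then have expand: "\<epsilon> * card U \<le> card (inner_boundary U)" if "U \<subseteq> X" "U \<noteq> {}" for U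
    using that by (meson linear)
  define \<theta> where "\<theta> = \<epsilon> / (8 * D)"
  have \<theta>: "\<theta> > 0"
    using assms(1) D_pos by (simp add: \<theta>_def)
  have pt: "max 0 ((cmod a)\<^sup>2 - (cmod b)\<^sup>2) \<le> (cmod (a - b))\<^sup>2 / (2 * \<theta>) + 2 * \<theta> * (cmod a)\<^sup>2"
    for a b :: complex
  proof (cases "cmod b \<le> cmod a")
    case True
    have "(cmod a)\<^sup>2 - (cmod b)\<^sup>2 = (cmod a - cmod b) * (cmod a + cmod b)"
      by (simp add: power2_eq_square algebra_simps)
    also have "\<dots> \<le> cmod (a - b) * (2 * cmod a)"
      using True norm_triangle_ineq2[of a b] by (intro mult_mono) auto
    also have "\<dots> \<le> (cmod (a - b))\<^sup>2 / (2 * \<theta>) + 2 * \<theta> * (cmod a)\<^sup>2"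
    proof -
      have "0 \<le> (cmod (a - b) - 2 * \<theta> * cmod a)\<^sup>2 / (2 * \<theta>)"
        using \<theta> by simp
      also have "\<dots> = (cmod (a - b))\<^sup>2 / (2 * \<theta>) + 2 * \<theta> * (cmod a)\<^sup>2 - cmod (a - b) * (2 * cmod a)"
        using \<theta> by (simp add: field_simps power2_eq_square)
      finally show ?thesis by simp
    qed
    finally show ?thesis
      using \<theta> by simp
  next
    case False
    then have "(cmod a)\<^sup>2 \<le> (cmod b)\<^sup>2"
      by (intro power_mono) auto
    then show ?thesis
      using \<theta> by (simp add: max_def)
  qed
  have "\<epsilon> * sqnorm f \<le> (\<Sum>y\<in>pverts G. \<Sum>z\<in>nbrs y. max 0 ((cmod (f y))\<^sup>2 - (cmod (f z))\<^sup>2))"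
    unfolding sqnorm_def using assms(3,4) by (intro coarea_inequality[of X] expand) auto
  also have "\<dots> \<le> (\<Sum>y\<in>pverts G. \<Sum>z\<in>nbrs y.
      (cmod (f y - f z))\<^sup>2 / (2 * \<theta>) + 2 * \<theta> * (cmod (f y))\<^sup>2)"
    by (intro sum_mono pt)
  also have "\<dots> = energy f / (2 * \<theta>) + (\<Sum>y\<in>pverts G. 2 * \<theta> * (cmod (f y))\<^sup>2 * card (nbrs y))"
    by (simp add: sum.distrib energy_def sum_divide_distrib mult.commute)
  also have "\<dots> \<le> energy f / (2 * \<theta>) + (\<Sum>y\<in>pverts G. 2 * \<theta> * (cmod (f y))\<^sup>2 * D)"
    using \<theta> card_nbrs_le by (intro add_mono order_refl sum_mono mult_left_mono) auto
  also have "\<dots> = energy f / (2 * \<theta>) + 2 * \<theta> * D * sqnorm f"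
    by (simp add: sqnorm_def sum_distrib_left mult_ac)
  also have "energy f / (2 * \<theta>) \<le> (\<epsilon>\<^sup>2 / (16 * D) * sqnorm f) / (2 * \<theta>)"
    using assms(5) \<theta> by (intro divide_right_mono) auto
  also have "\<dots> = \<epsilon> / 4 * sqnorm f"
    using assms(1) D_pos by (simp add: \<theta>_def power2_eq_square)
  also have "2 * \<theta> * D = \<epsilon> / 4"
    using D_pos by (simp add: \<theta>_def)
  finally have "\<epsilon> / 2 * sqnorm f \<le> 0"
    by simp
  moreover have "\<epsilon> / 2 * sqnorm f > 0"
    using assms(1,2) by simp
  ultimately show False
    by simp
qed


section \<open>Connected pieces and packing\<close>

definition spanned :: "'a set \<Rightarrow> 'a pair_pre_digraph" where
  "spanned U = \<lparr>pverts = U, parcs = {(x, y) \<in> parcs G. x \<in> U \<and> y \<in> U}\<rparr>"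

lemma pverts_spanned [simp]: "pverts (spanned U) = U"
  by (simp add: spanned_def)

lemma induced_spanned: "U \<subseteq> pverts G \<Longrightarrow> induced_subgraph (with_proj (spanned U)) (with_proj G)"
  using wf_digraph_axioms
  by (auto simp: induced_subgraph_def subgraph_def spanned_def wf_digraph_def compatible_def)

lemma vertex_boundary_spanned: "vertex_boundary G (spanned U) = inner_boundary U"
  by (simp add: vertex_boundary_def inner_boundary_def)

lemma disconnected_split:
  assumes "U \<noteq> {}" "\<not> Digraph_Component.connected (with_proj (spanned U))"
  obtains W where "W \<subseteq> U" "W \<noteq> {}" "U - W \<noteq> {}"
    "\<And>x y. x \<in> W \<Longrightarrow> y \<in> U - W \<Longrightarrow> (x, y) \<notin> parcs G"
proof -
  let ?R = "symcl (parcs (spanned U))"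
  obtain u v where uv: "u \<in> U" "v \<in> U" "(u, v) \<notin> rtrancl_on U ?R"
    using assms by (auto simp: connected_conv)
  define W where "W = {w \<in> U. (u, w) \<in> rtrancl_on U ?R}"
  show ?thesis
  proof (rule that[of W])
    fix x y assume xy: "x \<in> W" "y \<in> U - W"
    show "(x, y) \<notin> parcs G"
    proof
      assume "(x, y) \<in> parcs G"
      then have "(x, y) \<in> ?R"
        using xy by (auto simp: W_def symcl_def spanned_def)
      then have "(u, y) \<in> rtrancl_on U ?R"
        using xy by (auto simp: W_def intro: rtrancl_on_into_rtrancl_on)
      then show False
        using xy by (auto simp: W_def)
    qed
  qed (use uv in \<open>auto simp: W_def\<close>)
qed

text \<open>A smallest set with small boundary is connected: if it split into two parts without arcs
  between them, the boundaries of the parts would be disjoint subsets of its boundary, and one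
  of the parts would have small boundary.\<close>

lemma connected_small_boundary:
  fixes \<epsilon> :: real
  assumes "X \<subseteq> pverts G" "\<exists>U\<subseteq>X. U \<noteq> {} \<and> card (inner_boundary U) \<le> \<epsilon> * card U"
  shows "\<exists>U\<subseteq>X. U \<noteq> {} \<and> card (inner_boundary U) \<le> \<epsilon> * card U
    \<and> Digraph_Component.connected (with_proj (spanned U))"
proof -
  define Q where "Q U \<longleftrightarrow> U \<subseteq> X \<and> U \<noteq> {} \<and> card (inner_boundary U) \<le> \<epsilon> * card U" for U
  obtain U where U: "Q U" and min: "\<And>W. Q W \<Longrightarrow> card U \<le> card W"
    using assms(2) ex_has_least_nat[of Q _ card] unfolding Q_def by metis
  have fin: "finite U"
    using U assms(1) finite_V unfolding Q_def by (meson finite_subset subset_trans)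
  have "Digraph_Component.connected (with_proj (spanned U))"
  proof (rule ccontr)
    assume "\<not> ?thesis"
    then obtain W where W: "W \<subseteq> U" "W \<noteq> {}" "U - W \<noteq> {}"
      and sep: "\<And>x y. x \<in> W \<Longrightarrow> y \<in> U - W \<Longrightarrow> (x, y) \<notin> parcs G"
      using disconnected_split U unfolding Q_def by metis
    have cardU: "card U = card W + card (U - W)"
      using W(1) fin by (metis card_Diff_subset card_mono finite_subset le_add_diff_inverse)
    have "card W > 0" "card (U - W) > 0"
      using W fin finite_subset by (auto simp: card_gt_0_iff)
    then have "\<not> Q W" "\<not> Q (U - W)"
      using min[of W] min[of "U - W"] cardU by auto
    then have big: "\<epsilon> * card W < card (inner_boundary W)"
        "\<epsilon> * card (U - W) < card (inner_boundary (U - W))"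
      using U W by (auto simp: Q_def not_le)
    have sub: "inner_boundary W \<union> inner_boundary (U - W) \<subseteq> inner_boundary U"
      using W(1) sep arcs_symmetric by (fastforce simp: inner_boundary_def)
    have "card (inner_boundary W) + card (inner_boundary (U - W))
        = card (inner_boundary W \<union> inner_boundary (U - W))"
      using fin W(1) inner_boundary_subset[of W] inner_boundary_subset[of "U - W"]
      by (intro card_Un_disjoint[symmetric]) (auto intro: finite_subset)
    also have "\<dots> \<le> card (inner_boundary U)"
      using sub fin inner_boundary_subset[of U] by (intro card_mono) (auto intro: finite_subset)
    finally have "real (card (inner_boundary W)) + card (inner_boundary (U - W)) \<le> \<epsilon> * card U"
      using U by (simp add: Q_def)
    then show False
      using big by (simp add: cardU algebra_simps)
  qed
  then show ?thesis
    using U by (auto simp: Q_def)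
qed

definition ball :: "'a \<Rightarrow> nat \<Rightarrow> 'a set" where
  "ball x m = ((parcs G \<union> Id) ^^ m) `` {x}"

lemma ball_Suc: "ball x (Suc m) = (\<Union>y\<in>ball x m. insert y (nbrs y))"
  by (auto simp: ball_def nbrs_def)

lemma ball_subset: "x \<in> pverts G \<Longrightarrow> ball x m \<subseteq> pverts G"
  by (induction m) (use nbrs_subset in \<open>auto simp: ball_Suc, auto simp: ball_def\<close>)

lemma card_ball_le: "x \<in> pverts G \<Longrightarrow> card (ball x m) \<le> (D + 1) ^ m"
proof (induction m)
  case 0
  then show ?case by (simp add: ball_def)
next
  case (Suc m)
  have fin: "finite (ball x m)"
    using ball_subset[OF Suc.prems] finite_V by (rule finite_subset)
  have "card (ball x (Suc m)) \<le> (\<Sum>y\<in>ball x m. card (insert y (nbrs y)))"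
    unfolding ball_Suc by (rule card_UN_le[OF fin])
  also have "\<dots> \<le> (\<Sum>y\<in>ball x m. D + 1)"
  proof (rule sum_mono)
    fix y assume "y \<in> ball x m"
    then have "card (nbrs y) \<le> D"
      using ball_subset[OF Suc.prems] by (intro card_nbrs_le) auto
    then show "card (insert y (nbrs y)) \<le> D + 1"
      using card_insert_le_m1[of "D + 1" "nbrs y" y] by simp
  qed
  also have "\<dots> \<le> (D + 1) ^ m * (D + 1)"
    using Suc by (simp only: sum_constant) (intro mult_le_mono1, simp)
  finally show ?case by (simp add: mult.commute)
qed

lemma ball_sym: "y \<in> ball x m \<Longrightarrow> x \<in> ball y m"
proof -
  have "(x, y) \<in> (parcs G \<union> Id) ^^ m \<Longrightarrow> (y, x) \<in> (parcs G \<union> Id) ^^ m" for x y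
  proof (induction m arbitrary: y)
    case (Suc m)
    then obtain z where z: "(x, z) \<in> (parcs G \<union> Id) ^^ m" "(z, y) \<in> parcs G \<union> Id"
      by auto
    then have "(y, x) \<in> (parcs G \<union> Id) O (parcs G \<union> Id) ^^ m"
      using Suc.IH arcs_symmetric by blast
    then show ?case
      by (simp add: relpow_commute)
  qed simp
  then show "y \<in> ball x m \<Longrightarrow> x \<in> ball y m"
    by (simp add: ball_def)
qed

text \<open>Each step of the walk enlarges the support by one layer.\<close>

lemma heat_support: "heat m x y \<noteq> 0 \<Longrightarrow> y \<in> ball x m"
proof (induction m arbitrary: y)
  case 0
  then show ?case by (auto simp: heat_def ball_def split: if_splits)
next
  case (Suc m)
  show ?case
  proof (rule ccontr)
    assume out: "y \<notin> ball x (Suc m)"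
    then have "heat m x z = 0" if "z \<in> insert y (nbrs y)" for z
      using Suc.IH[of z] that nbrs_sym by (auto simp: ball_Suc)
    then have "heat (Suc m) x y = 0"
      by (simp add: heat_Suc lazy_step_def laplacian_eq)
    then show False
      using Suc.prems by simp
  qed
qed

text \<open>A maximum system meets every admissible piece. So every centre lies within distance
  \<open>m\<close> of one of the at most \<open>k\<close> vertices of a member, and each such vertex is close to at most
  \<open>k\<close> centres.\<close>

lemma packing_bound:
  fixes \<epsilon> :: real
  assumes P: "P \<subseteq> pverts G" and k: "(D + 1) ^ m \<le> k"
    and piece: "\<And>x. x \<in> P \<Longrightarrow> \<exists>U\<subseteq>ball x m. U \<noteq> {} \<and> card (inner_boundary U) \<le> \<epsilon> * card U
      \<and> Digraph_Component.connected (with_proj (spanned U))"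
  shows "card P \<le> Max {card \<A> |\<A>. isoperimetric_system G \<epsilon> k \<A>} * k\<^sup>2"
proof -
  let ?sys = "Collect (isoperimetric_system G \<epsilon> k)"
  have sub: "?sys \<subseteq> Pow (spanned ` Pow (pverts G))"
  proof
    fix \<A> assume sys: "\<A> \<in> ?sys"
    have "A = spanned (pverts A)" "pverts A \<subseteq> pverts G" if "A \<in> \<A>" for A
      using sys that
      by (auto simp: isoperimetric_system_def induced_subgraph_def subgraph_def spanned_def
          intro!: pair_pre_digraph.equality)
    then show "\<A> \<in> Pow (spanned ` Pow (pverts G))"
      by blast
  qed
  from sub have fin: "finite ?sys"
    by (rule finite_subset) (simp add: finite_V)
  have eq: "{card \<A> |\<A>. isoperimetric_system G \<epsilon> k \<A>} = card ` ?sys"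
    by auto
  have "{} \<in> ?sys"
    by (simp add: isoperimetric_system_def)
  then have "Max (card ` ?sys) \<in> card ` ?sys"
    using fin by (intro Max_in) auto
  then obtain \<A> where sys: "isoperimetric_system G \<epsilon> k \<A>" and card\<A>: "card \<A> = Max (card ` ?sys)"
    by auto
  have \<A>_fin: "finite \<A>"
    using sys sub by (intro finite_subset[of \<A> "spanned ` Pow (pverts G)"]) auto
  have memb: "finite (pverts A)" "pverts A \<subseteq> pverts G" "card (pverts A) \<le> k" if "A \<in> \<A>" for A
    using sys that
    by (auto simp: isoperimetric_system_def induced_subgraph_def subgraph_def
        intro: finite_subset[OF _ finite_V])
  have "P \<subseteq> (\<Union>A\<in>\<A>. \<Union>v\<in>pverts A. ball v m)"
  proof
    fix x assume x: "x \<in> P"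
    then obtain U where U: "U \<subseteq> ball x m" "U \<noteq> {}" "card (inner_boundary U) \<le> \<epsilon> * card U"
        "Digraph_Component.connected (with_proj (spanned U))"
      using piece by blast
    have xV: "x \<in> pverts G"
      using x P by auto
    have UV: "U \<subseteq> pverts G"
      using U(1) ball_subset[OF xV] by blast
    have U_fin: "finite U"
      using UV finite_V by (rule finite_subset)
    have "card U \<le> card (ball x m)"
      using U(1) finite_subset[OF ball_subset[OF xV] finite_V] by (intro card_mono)
    also have "\<dots> \<le> k"
      using card_ball_le[OF xV, of m] k by linarith
    finally have Uk: "card U \<le> k" .
    have "card U > 0"
      using U(2) U_fin by (simp add: card_gt_0_iff)
    then have ratio: "real (card (inner_boundary U)) / real (card U) \<le> \<epsilon>"
      using U(3) by (simp add: field_simps)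
    have "\<exists>A\<in>\<A>. \<not> disjnt (pverts A) U"
    proof (rule ccontr)
      assume "\<not> ?thesis"
      then have disj: "disjnt (pverts A) U" if "A \<in> \<A>" for A
        using that by blast
      then have "spanned U \<notin> \<A>"
        using U(2) by (force simp: disjnt_def)
      moreover have "isoperimetric_system G \<epsilon> k (insert (spanned U) \<A>)"
        using sys U(4) Uk ratio induced_spanned[OF UV] disj
        by (auto simp: isoperimetric_system_def vertex_boundary_spanned pairwise_insert
            disjnt_sym)
      then have "card (insert (spanned U) \<A>) \<le> Max (card ` ?sys)"
        using fin by (intro Max_ge) auto
      ultimately show False
        using card\<A> \<A>_fin by simp
    qed
    then obtain A v where "A \<in> \<A>" "v \<in> pverts A" "v \<in> ball x m"
      using U(1) by (auto simp: disjnt_def)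
    then show "x \<in> (\<Union>A\<in>\<A>. \<Union>v\<in>pverts A. ball v m)"
      using ball_sym by blast
  qed
  moreover have "finite (\<Union>A\<in>\<A>. \<Union>v\<in>pverts A. ball v m)"
  proof (intro finite_UN_I \<A>_fin memb(1))
    fix A v assume "A \<in> \<A>" "v \<in> pverts A"
    then have "v \<in> pverts G"
      using memb(2) by blast
    then show "finite (ball v m)"
      by (intro finite_subset[OF ball_subset finite_V])
  qed
  ultimately have "card P \<le> card (\<Union>A\<in>\<A>. \<Union>v\<in>pverts A. ball v m)"
    by (intro card_mono)
  also have "\<dots> \<le> (\<Sum>A\<in>\<A>. \<Sum>v\<in>pverts A. card (ball v m))"
    using memb \<A>_fin by (intro order_trans[OF card_UN_le] sum_mono card_UN_le) auto
  also have "\<dots> \<le> (\<Sum>A\<in>\<A>. \<Sum>v\<in>pverts A. k)"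
    using memb card_ball_le k by (intro sum_mono) (meson order_trans subsetD)
  also have "\<dots> \<le> (\<Sum>A\<in>\<A>. k * k)"
    using memb by (intro sum_mono) auto
  finally show ?thesis
    by (simp add: card\<A> eq power2_eq_square)
qed


section \<open>Many centres of low energy\<close>

text \<open>If every one of the first \<open>M\<close> steps lost a fraction \<open>b\<close> of the heat mass, the mass after
  \<open>M\<close> steps would be below the lower bound that the small eigenvalues provide.\<close>

lemma ex_step_small_loss:
  fixes b t :: real
  assumes "0 \<le> b" "b \<le> 1" "t * card (pverts G) * (1 - b / 2) ^ M \<le> heat_mass M"
    and "((1 - b) / (1 - b / 2)) ^ M < t" and "pverts G \<noteq> {}"
  shows "\<exists>m<M. (1 - b) * heat_mass m \<le> heat_mass (Suc m)"
proof (rule ccontr)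
  assume "\<not> ?thesis"
  then have loss: "heat_mass (Suc m) \<le> (1 - b) * heat_mass m" if "m < M" for m
    using that by force
  have "m \<le> M \<Longrightarrow> heat_mass m \<le> (1 - b) ^ m * card (pverts G)" for m
  proof (induction m)
    case (Suc m)
    then have "heat_mass (Suc m) \<le> (1 - b) * heat_mass m"
      using loss by simp
    also have "\<dots> \<le> (1 - b) * ((1 - b) ^ m * card (pverts G))"
      using Suc assms by (intro mult_left_mono) auto
    finally show ?case by (simp add: mult.assoc)
  qed (simp add: heat_mass_0)
  from this[of M] have "t * card (pverts G) * (1 - b / 2) ^ M \<le> (1 - b) ^ M * card (pverts G)"
    using assms(3) by simp
  moreover have "card (pverts G) > 0"
    using assms(5) by (simp add: card_gt_0_iff)
  ultimately have "t * (1 - b / 2) ^ M \<le> (1 - b) ^ M"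
    by (simp add: mult.commute mult.left_commute)
  moreover have "(1 - b / 2) ^ M > 0"
    using assms(2) by simp
  ultimately have "t \<le> (1 - b) ^ M / (1 - b / 2) ^ M"
    by (simp add: field_simps)
  then show False
    using assms(4) by (simp add: power_divide)
qed

text \<open>At a step with small loss the average energy is small. Centres of large energy carry at
  most half of the heat mass, and since each single function has mass at most \<open>1\<close>, the
  number of the other centres is at least half of the heat mass.\<close>

lemma card_low_energy_centres:
  fixes b \<kappa> :: real
  assumes "0 < \<kappa>" "8 * D * b \<le> \<kappa>" "(1 - b) * heat_mass m \<le> heat_mass (Suc m)"
  shows "heat_mass m / 2
    \<le> card {x \<in> pverts G. sqnorm (heat m x) > 0 \<and> energy (heat m x) \<le> \<kappa> * sqnorm (heat m x)}"
    (is "_ \<le> real (card ?P)")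
proof -
  define B where "B = {x \<in> pverts G. \<kappa> * sqnorm (heat m x) < energy (heat m x)}"
  have mass_nonneg: "heat_mass m \<ge> 0"
    by (simp add: heat_mass_def sum_nonneg sqnorm_nonneg)
  have "(\<Sum>x\<in>pverts G. energy (heat m x))
      \<le> (\<Sum>x\<in>pverts G. 4 * D * (sqnorm (heat m x) - sqnorm (heat (Suc m) x)))"
  proof (rule sum_mono)
    show "energy (heat m x) \<le> 4 * D * (sqnorm (heat m x) - sqnorm (heat (Suc m) x))" for x
      using energy_le_mass_loss[of "heat m x"] by (simp add: heat_Suc)
  qed
  also have "\<dots> = 4 * D * (heat_mass m - heat_mass (Suc m))"
    by (simp add: heat_mass_def flip: sum_distrib_left sum_subtractf)
  also have "\<dots> \<le> 4 * D * (b * heat_mass m)"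
    using assms(3) by (intro mult_left_mono) (auto simp: algebra_simps)
  also have "\<dots> \<le> \<kappa> / 2 * heat_mass m"
    using mult_right_mono[OF assms(2) mass_nonneg] by simp
  finally have total: "(\<Sum>x\<in>pverts G. energy (heat m x)) \<le> \<kappa> / 2 * heat_mass m" .
  have "\<kappa> * (\<Sum>x\<in>B. sqnorm (heat m x)) \<le> (\<Sum>x\<in>B. energy (heat m x))"
    unfolding sum_distrib_left by (intro sum_mono) (auto simp: B_def)
  also have "\<dots> \<le> (\<Sum>x\<in>pverts G. energy (heat m x))"
    by (intro sum_mono2) (auto simp: B_def energy_nonneg)
  also note total
  finally have bad: "(\<Sum>x\<in>B. sqnorm (heat m x)) \<le> heat_mass m / 2"
    using assms(1) by simp
  have "heat_mass m = (\<Sum>x\<in>B. sqnorm (heat m x)) + (\<Sum>x\<in>pverts G - B. sqnorm (heat m x))"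
    unfolding heat_mass_def by (subst sum.subset_diff[of B]) (auto simp: B_def)
  moreover have "(\<Sum>x\<in>pverts G - B. sqnorm (heat m x)) = (\<Sum>x\<in>?P. sqnorm (heat m x))"
  proof (rule sum.mono_neutral_right)
    show "\<forall>x\<in>pverts G - B - ?P. sqnorm (heat m x) = 0"
      using sqnorm_nonneg by (force simp: B_def not_less le_less)
  qed (auto simp: B_def)
  moreover have "(\<Sum>x\<in>?P. sqnorm (heat m x)) \<le> (\<Sum>x\<in>?P. 1)"
    by (intro sum_mono) (auto intro: sqnorm_heat_le)
  ultimately show ?thesis
    using bad by simp
qed

end

theorem theorem2:
  fixes \<epsilon> :: real and d :: nat
  assumes "\<epsilon> > 0"
  shows "\<exists>E::real. E > 0 \<and>
    (\<forall>t::real. t > 0 \<longrightarrow>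
      (\<exists>(k::nat) (n::nat) (s::real). s > 0 \<and>
        (\<forall>G :: 'a pair_pre_digraph.
           pair_graph G
           \<and> Digraph_Component.connected (with_proj G)
           \<and> (\<forall>x\<in>pverts G. out_degree (with_proj G) x \<le> d)
           \<and> card (pverts G) \<ge> n
           \<and> small_eigenvalue_ratio G E \<ge> t
           \<longrightarrow> isoperimetric_ratio G \<epsilon> k \<ge> s)))"
proof -
  (* positive even if d = 0 *)
  define D where "D = d + 1"
  define \<kappa> where "\<kappa> = \<epsilon>\<^sup>2 / (16 * D)"
  (* 8 * D * b <= \<kappa> is what the averaging over centres needs *)
  define b where "b = min (1 / 2) (\<kappa> / (8 * D))"
  (* then (1 - E / (2 * D))^2 >= 1 - b / 2, so the share of the small eigenvalues in the heat mass
     decays more slowly than the powers of 1 - b *)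
  define E where "E = D * b / 2"
  have D: "D > 0"
    by (simp add: D_def)
  have \<kappa>: "\<kappa> > 0"
    using assms D by (simp add: \<kappa>_def)
  have b: "0 < b" "b \<le> 1 / 2" "8 * D * b \<le> \<kappa>"
  proof -
    have "b \<le> \<kappa> / (8 * D)"
      by (simp add: b_def)
    then show "8 * D * b \<le> \<kappa>"
      using D by (simp add: field_simps)
  qed (use \<kappa> D in \<open>auto simp: b_def\<close>)
  define c where "c = 1 - E / (2 * D)"
  have c: "c = 1 - b / 4" "0 < c" "c \<le> 1"
    using D b by (auto simp: c_def E_def)
  have c2: "1 - b / 2 \<le> c\<^sup>2"
    by (simp add: c(1) power2_eq_square algebra_simps)
  have E: "E > 0" "E \<le> 2 * D"
    using D b by (auto simp: E_def)
  have q: "(1 - b) / (1 - b / 2) < 1"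
    using b by simp
  show ?thesis
  proof (intro exI[of _ E] conjI E(1) allI impI)
    fix t :: real assume t: "t > 0"
    obtain M where M: "((1 - b) / (1 - b / 2)) ^ M < t"
      using real_arch_pow_inv[OF t q] by blast
    define k where "k = (D + 1) ^ M"
    have k: "k > 0"
      by (simp add: k_def)
    define s where "s = t * c ^ (2 * M) / (2 * k\<^sup>2)"
    have s: "s > 0"
      using t c k by (simp add: s_def)
    have main: "s \<le> isoperimetric_ratio G \<epsilon> k"
      if G: "pair_graph G" "\<forall>x\<in>pverts G. out_degree (with_proj G) x \<le> d"
        and ne: "card (pverts G) \<ge> 1" and ratio: "small_eigenvalue_ratio G E \<ge> t"
      for G :: "'a pair_pre_digraph"
    proof -
      interpret bounded_degree_graph G D
        using G by (intro bounded_degree_graph.intro bounded_degree_graph_axioms.intro)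
          (auto simp: D_def intro: le_SucI)
      define N where "N = card (pverts G)"
      have N: "N > 0"
        using ne by (simp add: N_def)
      have many: "t * N \<le> num_small_eigenvalues G E"
        using ratio N by (simp add: small_eigenvalue_ratio_def N_def field_simps)
      have mass: "c ^ (2 * m) * (t * N) \<le> heat_mass m" for m
      proof -
        have "c ^ (2 * m) * (t * N) \<le> c ^ (2 * m) * num_small_eigenvalues G E"
          using c(2) by (intro mult_left_mono many) simp
        also have "\<dots> \<le> heat_mass m"
          unfolding c_def by (rule num_small_eigenvalues_heat_mass[OF E(2)])
        finally show ?thesis .
      qed
      have "(1 - b / 2) ^ M \<le> c ^ (2 * M)"
        unfolding power_mult using c2 b by (intro power_mono) auto
      then have "(t * N) * (1 - b / 2) ^ M \<le> (t * N) * c ^ (2 * M)"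
        using t by (intro mult_left_mono) auto
      also have "\<dots> \<le> heat_mass M"
        using mass[of M] by (simp add: mult.commute)
      finally obtain m where m: "m < M" "(1 - b) * heat_mass m \<le> heat_mass (Suc m)"
        using ex_step_small_loss[of b t M] M b N by (auto simp: N_def card_gt_0_iff)
      define P where "P = {x \<in> pverts G. sqnorm (heat m x) > 0
        \<and> energy (heat m x) \<le> \<kappa> * sqnorm (heat m x)}"
      have "c ^ (2 * M) \<le> c ^ (2 * m)"
        using c m(1) by (intro power_decreasing) auto
      then have "(t * N) * c ^ (2 * M) \<le> (t * N) * c ^ (2 * m)"
        using t by (intro mult_left_mono) auto
      also have "\<dots> \<le> heat_mass m"
        using mass[of m] by (simp add: mult.commute)
      also have "\<dots> \<le> 2 * card P"
        using card_low_energy_centres[OF \<kappa> b(3) m(2)] by (simp add: P_def)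
      finally have cardP: "(t * N) * c ^ (2 * M) \<le> 2 * card P" .
      have "card P \<le> Max {card \<A> |\<A>. isoperimetric_system G \<epsilon> k \<A>} * k\<^sup>2"
      proof (rule packing_bound[of _ m])
        show "(D + 1) ^ m \<le> k"
          unfolding k_def using m(1) by (intro power_increasing) auto
        fix x assume x: "x \<in> P"
        then have X: "ball x m \<subseteq> pverts G"
          by (intro ball_subset) (simp add: P_def)
        show "\<exists>U\<subseteq>ball x m. U \<noteq> {} \<and> card (inner_boundary U) \<le> \<epsilon> * card U
            \<and> Digraph_Component.connected (with_proj (spanned U))"
          using x heat_support
          by (intro connected_small_boundary[OF X]
              low_energy_imp_small_boundary[OF assms _ X, of "heat m x"])
            (auto simp: P_def \<kappa>_def)
      qed (auto simp: P_def)
      then have "real (card P) \<le> real (Max {card \<A> |\<A>. isoperimetric_system G \<epsilon> k \<A>} * k\<^sup>2)"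
        by (rule of_nat_mono)
      then have "real (card P) \<le> real (Max {card \<A> |\<A>. isoperimetric_system G \<epsilon> k \<A>}) * (real k)\<^sup>2"
        by (simp only: of_nat_mult of_nat_power)
      then have "(t * N) * c ^ (2 * M)
          \<le> 2 * (real (Max {card \<A> |\<A>. isoperimetric_system G \<epsilon> k \<A>}) * (real k)\<^sup>2)"
        using cardP by linarith
      then show ?thesis
        using N k by (simp add: s_def isoperimetric_ratio_def N_def[symmetric] field_simps)
    qed
    show "\<exists>(k::nat) (n::nat) (s::real). s > 0 \<and>
        (\<forall>G :: 'a pair_pre_digraph.
           pair_graph G
           \<and> Digraph_Component.connected (with_proj G)
           \<and> (\<forall>x\<in>pverts G. out_degree (with_proj G) x \<le> d)
           \<and> card (pverts G) \<ge> n
           \<and> small_eigenvalue_ratio G E \<ge> t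
           \<longrightarrow> isoperimetric_ratio G \<epsilon> k \<ge> s)"
      (* n = 1 makes the vertex set nonempty *)
      by (intro exI[of _ k] exI[of _ "1::nat"] exI[of _ s] conjI s allI impI, elim conjE, rule main)
  qed
qed

end
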